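(* Let $a,b,c,\alpha>0$, and put $\hat\sigma^2(f)=\dfrac{c(a+b)}{(a+b)^2+(2\pi f)^2}$ for $f\in\mathbb{R}$, $\beta_1=\dfrac{2\pi^2}{\alpha c(a+b)}$ and $\beta_2=\dfrac{(a+b)^2}{4\pi^2}$. Then $$C_\approx:=\frac{1}{\ln 2}\int_{-\infty}^{\infty}\exp\left(\frac{1}{2\alpha\hat\sigma^2(f)}\right)\mathrm{Ei}_1\left(\frac{1}{2\alpha\hat\sigma^2(f)}\right)df=\frac{\pi}{\ln(2)\sqrt{\beta_1}}\exp(\beta_1\beta_2)\,\Gamma\left(\tfrac12,\beta_1\beta_2\right).$$
   Context: For $z>0$: $\mathrm{Ei}_1(z)=\int_1^\infty e^{-tz}t^{-1}\,dt$, and $\Gamma(\mu,z)=\int_z^\infty e^{-t}t^{\mu-1}\,dt$ is the upper incomplete gamma function. *)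

theory Defs
  imports "HOL-Analysis.Analysis"
begin

(* Ei1 z and upper_incomplete_Gamma mu z are intended for z > 0, where both integrands
   are integrable; the library integral returns 0 for a non-integrable integrand. *)

definition Ei1 :: "real \<Rightarrow> real" where
  "Ei1 z = (LINT t:{1..}|lborel. exp (- t * z) * inverse t)"

definition upper_incomplete_Gamma :: "real \<Rightarrow> real \<Rightarrow> real" where
  "upper_incomplete_Gamma \<mu> z = (LINT t:{z..}|lborel. exp (- t) * t powr (\<mu> - 1))"

definition sigma_hat_sq :: "real \<Rightarrow> real \<Rightarrow> real \<Rightarrow> real \<Rightarrow> real" where
  "sigma_hat_sq a b c f = c * (a + b) / ((a + b)\<^sup>2 + (2 * pi * f)\<^sup>2)"

definition C_approx_integrand :: "real \<Rightarrow> real \<Rightarrow> real \<Rightarrow> real \<Rightarrow> real \<Rightarrow> real" where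
  "C_approx_integrand a b c \<alpha> f =
     exp (1 / (2 * \<alpha> * sigma_hat_sq a b c f)) * Ei1 (1 / (2 * \<alpha> * sigma_hat_sq a b c f))"

definition C_approx :: "real \<Rightarrow> real \<Rightarrow> real \<Rightarrow> real \<Rightarrow> real" where
  "C_approx a b c \<alpha> = 1 / ln 2 * (LINT f|lborel. C_approx_integrand a b c \<alpha> f)"

end

(*
  For z > 0, exp z * Ei1 z = \<integral> exp (-u) / (z + u) du over u \<ge> 0: write 1 / t as
  \<integral> exp (-t u) du and exchange the integrals.  With z = \<beta>\<^sub>1 (f\<^sup>2 + \<beta>\<^sub>2) a second exchange
  leaves the inner integral \<integral> df / (\<beta>\<^sub>1 f\<^sup>2 + \<beta>\<^sub>1 \<beta>\<^sub>2 + u) = \<pi> / sqrt (\<beta>\<^sub>1 (\<beta>\<^sub>1 \<beta>\<^sub>2 + u)), and the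
  substitution v = \<beta>\<^sub>1 \<beta>\<^sub>2 + u gives the incomplete gamma function.  All integrands are
  nonnegative, so Tonelli suffices and integrability is obtained along with the value.
*)
theory Submission
  imports Defs
begin

text \<open>Bridge from the Bochner integrals in the definitions to nonnegative integrals:
  finiteness gives integrability, so the default value 0 does not arise. The sign is demanded only
  on \<open>A\<close>, since for instance \<open>inverse t\<close> is negative for t < 0.\<close>

lemma ennreal_set_integral_eq_set_nn_integral:
  fixes f :: "'a \<Rightarrow> real"
  assumes [measurable]: "f \<in> borel_measurable M" "A \<in> sets M"
    and nonneg: "\<And>x. x \<in> A \<Longrightarrow> 0 \<le> f x"
    and fin: "(\<integral>\<^sup>+x\<in>A. ennreal (f x) \<partial>M) < \<infinity>"
  shows "ennreal (LINT x:A|M. f x) = (\<integral>\<^sup>+x\<in>A. ennreal (f x) \<partial>M)"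
proof -
  have eq: "(\<integral>\<^sup>+x. ennreal (indicator A x *\<^sub>R f x) \<partial>M) = (\<integral>\<^sup>+x\<in>A. ennreal (f x) \<partial>M)"
    by (intro nn_integral_cong) (simp split: split_indicator)
  have ae: "AE x in M. 0 \<le> indicator A x *\<^sub>R f x"
    using nonneg by (intro AE_I2) (simp split: split_indicator)
  have "integrable M (\<lambda>x. indicator A x *\<^sub>R f x)"
    using fin eq by (intro integrableI_nonneg ae) simp_all
  then show ?thesis
    using nn_integral_eq_integral[OF _ ae] eq by (simp add: set_lebesgue_integral_def)
qed

lemma set_nn_integral_exp_atLeast:
  fixes a z :: real
  assumes "0 < z"
  shows "(\<integral>\<^sup>+t\<in>{a..}. ennreal (exp (- t * z)) \<partial>lborel) = ennreal (exp (- a * z) / z)"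
proof -
  have "LIM t at_top. z * t :> at_top"
    using assms by (intro filterlim_tendsto_pos_mult_at_top[OF tendsto_const _ filterlim_ident])
  then have "LIM t at_top. - t * z :> at_bot"
    by (simp add: filterlim_uminus_at_top mult.commute)
  \<comment> \<open>The limit is left as \<open>- 0 / z\<close>, the shape that the limit rules
    build from exp (- t z) tending to 0.\<close>
  then have "((\<lambda>t. - exp (- t * z) / z) \<longlongrightarrow> - 0 / z) at_top"
    using assms by (intro tendsto_intros filterlim_compose[OF exp_at_bot]) auto
  then have "(\<integral>\<^sup>+t\<in>{a..}. ennreal (exp (- t * z)) \<partial>lborel) = ennreal (- 0 / z - (- exp (- a * z) / z))"
    using assms by (intro nn_integral_FTC_atLeast) (auto intro!: derivative_eq_intros)
  then show ?thesis by simp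
qed

text \<open>The antiderivative \<open>F\<close> is a scaled arctangent that rises from -pi/2 to
  pi/2, divided by \<open>sqrt (p * K)\<close>. As the integrand is nonnegative, the fundamental
  theorem on the whole line yields integrability together with the value.\<close>

lemma nn_integral_inverse_quadratic:
  fixes p K :: real
  assumes "0 < p" "0 < K"
  shows "(\<integral>\<^sup>+x. ennreal (1 / (p * x\<^sup>2 + K)) \<partial>lborel) = ennreal (pi / sqrt (p * K))"
proof -
  define F where "F = (\<lambda>x. arctan (x * sqrt (p / K)) / sqrt (p * K))"
  have pos: "0 < p * x\<^sup>2 + K" for x
    using assms by (simp add: add_nonneg_pos)
  \<comment> \<open>The chain-rule factor and the normalisation of \<open>F\<close> combine to 1 /
    K, which turns 1 / (1 + x^2 p / K) into 1 / (p x^2 + K).\<close>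
  have sqrts: "sqrt (p / K) / sqrt (p * K) = 1 / K"
    using assms by (simp add: real_sqrt_divide real_sqrt_mult)
  have deriv: "DERIV F x :> 1 / (p * x\<^sup>2 + K)" for x
  proof -
    have "sqrt (p / K) / (1 + (x * sqrt (p / K))\<^sup>2) / sqrt (p * K)
        = (sqrt (p / K) / sqrt (p * K)) / (1 + x\<^sup>2 * (p / K))"
      using assms by (simp add: power_mult_distrib)
    also have "\<dots> = 1 / (p * x\<^sup>2 + K)"
      unfolding sqrts using assms pos[of x] by (simp add: field_simps)
    finally have deriv_eq: "sqrt (p / K) / (1 + (x * sqrt (p / K))\<^sup>2) / sqrt (p * K) = 1 / (p * x\<^sup>2 + K)" .
    \<comment> \<open>Differentiating with arbitrary \<open>r\<close> and \<open>q\<close> keeps the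
      square roots from being rewritten.\<close>
    have "DERIV (\<lambda>x. arctan (x * r) / q) x :> r / (1 + (x * r)\<^sup>2) / q" for r q :: real
      by (rule DERIV_cdivide) (auto intro!: derivative_eq_intros simp: divide_inverse)
    from this[of "sqrt (p / K)" "sqrt (p * K)"] show ?thesis
      unfolding F_def deriv_eq .
  qed
  have slope: "0 < sqrt (p / K)"
    using assms by simp
  have "LIM x at_top. sqrt (p / K) * x :> at_top"
    by (rule filterlim_tendsto_pos_mult_at_top[OF tendsto_const slope filterlim_ident])
  then have "(F \<longlongrightarrow> pi / 2 / sqrt (p * K)) at_top"
    unfolding F_def using assms
    by (intro tendsto_divide tendsto_const filterlim_compose[OF tendsto_arctan_at_top])
      (simp_all add: mult.commute)
  then have top: "((F \<circ> real_of_ereal) \<longlongrightarrow> pi / 2 / sqrt (p * K)) (at_left \<infinity>)"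
    by (simp add: ereal_tendsto_simps1)
  have "LIM x at_bot. sqrt (p / K) * x :> at_bot"
    by (rule filterlim_tendsto_pos_mult_at_bot[OF tendsto_const slope filterlim_ident])
  then have "(F \<longlongrightarrow> - (pi / 2) / sqrt (p * K)) at_bot"
    unfolding F_def using assms
    by (intro tendsto_divide tendsto_const filterlim_compose[OF tendsto_arctan_at_bot])
      (simp_all add: mult.commute)
  then have bot: "((F \<circ> real_of_ereal) \<longlongrightarrow> - (pi / 2) / sqrt (p * K)) (at_right (-\<infinity>))"
    by (simp add: ereal_tendsto_simps1)
  have cont: "isCont (\<lambda>x. 1 / (p * x\<^sup>2 + K)) x" for x
    using pos[of x] by (intro continuous_intros) simp
  have ae: "AE x in lborel. -\<infinity> < ereal x \<longrightarrow> ereal x < \<infinity> \<longrightarrow> 0 \<le> 1 / (p * x\<^sup>2 + K)"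
    using pos[THEN less_imp_le] by simp
  have "set_integrable lborel (einterval (-\<infinity>) \<infinity>) (\<lambda>x. 1 / (p * x\<^sup>2 + K))"
    and "(LBINT x=-\<infinity>..\<infinity>. 1 / (p * x\<^sup>2 + K)) = pi / 2 / sqrt (p * K) - (- (pi / 2) / sqrt (p * K))"
    by (rule interval_integral_FTC_nonneg[OF _ deriv cont ae bot top], simp)+
  then have "integrable lborel (\<lambda>x. 1 / (p * x\<^sup>2 + K))"
    and "(LBINT x. 1 / (p * x\<^sup>2 + K)) = pi / sqrt (p * K)"
    by (simp_all add: set_integrable_def interval_lebesgue_integral_def set_lebesgue_integral_def)
  then show ?thesis
    using pos[THEN less_imp_le] by (simp add: nn_integral_eq_integral)
qed

text \<open>On t \<ge> 1 the factor 1 / t is at most 1, so exp (- t z) dominates, and its integral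
  is finite because z > 0.\<close>

lemma ennreal_Ei1:
  assumes "0 < z"
  shows "ennreal (Ei1 z) = (\<integral>\<^sup>+t\<in>{1..}. ennreal (exp (- t * z) * inverse t) \<partial>lborel)"
proof -
  have "(\<integral>\<^sup>+t\<in>{1..}. ennreal (exp (- t * z) * inverse t) \<partial>lborel)
      \<le> (\<integral>\<^sup>+t\<in>{1..}. ennreal (exp (- t * z)) \<partial>lborel)"
    by (intro nn_integral_mono) (auto split: split_indicator intro!: ennreal_leI simp: field_simps)
  also have "\<dots> < \<infinity>"
    using assms by (simp add: set_nn_integral_exp_atLeast[OF assms, simplified])
  finally show ?thesis
    unfolding Ei1_def by (intro ennreal_set_integral_eq_set_nn_integral) auto
qed

lemma ennreal_exp_mult_Ei1:
  fixes z :: real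
  assumes "0 < z"
  shows "ennreal (exp z * Ei1 z) = (\<integral>\<^sup>+u\<in>{0..}. ennreal (exp (- u) / (z + u)) \<partial>lborel)"
proof -
  \<comment> \<open>The integral of exp (- t u) over u \<ge> 0 replaces 1 / t. Both indicators stay
    in the integrand, which is thus a single measurable function of (t, u), ready for Tonelli; for t
    < 1 both sides vanish.\<close>
  have inv: "ennreal (exp (- t * z) * inverse t) * indicator {1..} t
      = (\<integral>\<^sup>+u. ennreal (exp (- t * (z + u))) * indicator {1..} t * indicator {0..} u \<partial>lborel)" for t :: real
  proof (cases "1 \<le> t")
    case True
    have "(\<integral>\<^sup>+u. ennreal (exp (- t * (z + u))) * indicator {1..} t * indicator {0..} u \<partial>lborel)
        = (\<integral>\<^sup>+u. ennreal (exp (- t * z)) * (ennreal (exp (- u * t)) * indicator {0..} u) \<partial>lborel)"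
      using True by (intro nn_integral_cong)
        (simp split: split_indicator add: ennreal_mult'[symmetric] exp_add[symmetric] algebra_simps)
    also have "\<dots> = ennreal (exp (- t * z)) * ennreal (exp (- 0 * t) / t)"
      using True by (subst nn_integral_cmult) (simp_all only: set_nn_integral_exp_atLeast, simp_all)
    finally show ?thesis
      using True by (simp add: ennreal_mult'[symmetric] divide_inverse)
  qed simp
  have "ennreal (exp z * Ei1 z) = ennreal (exp z) * (\<integral>\<^sup>+t\<in>{1..}. ennreal (exp (- t * z) * inverse t) \<partial>lborel)"
    by (simp only: ennreal_mult' exp_ge_zero ennreal_Ei1[OF assms])
  also have "(\<integral>\<^sup>+t\<in>{1..}. ennreal (exp (- t * z) * inverse t) \<partial>lborel)
      = (\<integral>\<^sup>+t. \<integral>\<^sup>+u. ennreal (exp (- t * (z + u))) * indicator {1..} t * indicator {0..} u \<partial>lborel \<partial>lborel)"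
    by (simp only: inv)
  also have "\<dots> = (\<integral>\<^sup>+u. \<integral>\<^sup>+t. ennreal (exp (- t * (z + u))) * indicator {1..} t * indicator {0..} u \<partial>lborel \<partial>lborel)"
    by (intro lborel_pair.Fubini') measurable
  \<comment> \<open>The inner integral over t \<ge> 1 is an exponential tail of rate z + u > 0; its
    factor exp (- z) cancels against exp z afterwards.\<close>
  also have "\<dots> = (\<integral>\<^sup>+u\<in>{0..}. ennreal (exp (- (z + u)) / (z + u)) \<partial>lborel)"
  proof (intro nn_integral_cong)
    fix u :: real
    show "(\<integral>\<^sup>+t. ennreal (exp (- t * (z + u))) * indicator {1..} t * indicator {0..} u \<partial>lborel)
        = ennreal (exp (- (z + u)) / (z + u)) * indicator {0..} u"
      using assms set_nn_integral_exp_atLeast[of "z + u" 1] by (cases "0 \<le> u") simp_all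
  qed
  also have "ennreal (exp z) * \<dots> = (\<integral>\<^sup>+u\<in>{0..}. ennreal (exp (- u) / (z + u)) \<partial>lborel)"
    by (subst nn_integral_cmult[symmetric], simp, intro nn_integral_cong)
      (simp split: split_indicator add: ennreal_mult'[symmetric] exp_add[symmetric])
  finally show ?thesis .
qed

text \<open>For v \<ge> z > 0 the power v powr (-1/2) is 1 / sqrt v, which is at most 1 / sqrt z;
  the tail of exp (- v) therefore bounds the integral.\<close>

lemma ennreal_upper_incomplete_Gamma_half:
  assumes "0 < z"
  shows "ennreal (upper_incomplete_Gamma (1 / 2) z) = (\<integral>\<^sup>+v\<in>{z..}. ennreal (exp (- v) / sqrt v) \<partial>lborel)"
proof -
  have powr: "exp (- v) * v powr (1 / 2 - 1) = exp (- v) / sqrt v" if "z \<le> v" for v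
  proof -
    have "v powr (1 / 2 - 1) = inverse (v powr (1 / 2))"
      by (subst powr_minus[symmetric]) simp
    also have "v powr (1 / 2) = sqrt v"
      using assms that by (intro powr_half_sqrt) simp
    finally show ?thesis
      by (simp only: divide_inverse)
  qed
  have eq: "(\<integral>\<^sup>+v\<in>{z..}. ennreal (exp (- v) * v powr (1 / 2 - 1)) \<partial>lborel)
      = (\<integral>\<^sup>+v\<in>{z..}. ennreal (exp (- v) / sqrt v) \<partial>lborel)"
  proof (rule nn_integral_cong)
    fix v :: real
    show "ennreal (exp (- v) * v powr (1 / 2 - 1)) * indicator {z..} v
        = ennreal (exp (- v) / sqrt v) * indicator {z..} v"
    proof (cases "z \<le> v")
      case True
      show ?thesis by (simp only: powr[OF True])
    qed simp
  qed
  have "exp (- v) / sqrt v \<le> 1 / sqrt z * exp (- v)" if "z \<le> v" for v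
    using divide_left_mono[of "sqrt z" "sqrt v" "exp (- v)"] assms that by simp
  then have "(\<integral>\<^sup>+v\<in>{z..}. ennreal (exp (- v) / sqrt v) \<partial>lborel)
      \<le> (\<integral>\<^sup>+v. ennreal (1 / sqrt z) * (ennreal (exp (- v * 1)) * indicator {z..} v) \<partial>lborel)"
    using assms by (intro nn_integral_mono)
      (simp split: split_indicator add: ennreal_leI ennreal_mult'[symmetric])
  also have "\<dots> = ennreal (1 / sqrt z) * ennreal (exp (- z * 1) / 1)"
    by (subst nn_integral_cmult, simp, subst set_nn_integral_exp_atLeast) simp_all
  also have "\<dots> < \<infinity>"
    by (simp add: ennreal_mult_less_top)
  finally show ?thesis
    unfolding upper_incomplete_Gamma_def eq[symmetric]
    by (intro ennreal_set_integral_eq_set_nn_integral) auto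
qed

lemma nn_integral_exp_mult_Ei1_quadratic:
  fixes p K :: real
  assumes "0 < p" "0 < K"
  shows "(\<integral>\<^sup>+x. ennreal (exp (p * x\<^sup>2 + K) * Ei1 (p * x\<^sup>2 + K)) \<partial>lborel)
    = ennreal (pi / sqrt p * exp K * upper_incomplete_Gamma (1 / 2) K)"
proof -
  have pos: "0 < p * x\<^sup>2 + K" for x
    using assms by (simp add: add_nonneg_pos)
  have "(\<integral>\<^sup>+x. ennreal (exp (p * x\<^sup>2 + K) * Ei1 (p * x\<^sup>2 + K)) \<partial>lborel)
      = (\<integral>\<^sup>+x. \<integral>\<^sup>+u. ennreal (exp (- u) / (p * x\<^sup>2 + K + u)) * indicator {0..} u \<partial>lborel \<partial>lborel)"
    by (simp only: ennreal_exp_mult_Ei1[OF pos])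
  also have "\<dots> = (\<integral>\<^sup>+u. \<integral>\<^sup>+x. ennreal (exp (- u) / (p * x\<^sup>2 + K + u)) * indicator {0..} u \<partial>lborel \<partial>lborel)"
    by (intro lborel_pair.Fubini') measurable
  also have "\<dots> = (\<integral>\<^sup>+u. ennreal (exp (- u) * (pi / sqrt (p * (K + u)))) * indicator {0..} u \<partial>lborel)"
  proof (rule nn_integral_cong)
    fix u :: real
    show "(\<integral>\<^sup>+x. ennreal (exp (- u) / (p * x\<^sup>2 + K + u)) * indicator {0..} u \<partial>lborel)
        = ennreal (exp (- u) * (pi / sqrt (p * (K + u)))) * indicator {0..} u"
    proof (cases "0 \<le> u")
      case True
      have "(\<integral>\<^sup>+x. ennreal (exp (- u) / (p * x\<^sup>2 + K + u)) * indicator {0..} u \<partial>lborel)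
          = (\<integral>\<^sup>+x. ennreal (exp (- u)) * ennreal (1 / (p * x\<^sup>2 + (K + u))) \<partial>lborel)"
        using True by (simp add: ennreal_mult'[symmetric] add.assoc)
      also have "\<dots> = ennreal (exp (- u)) * ennreal (pi / sqrt (p * (K + u)))"
        using True assms by (subst nn_integral_cmult) (simp_all only: nn_integral_inverse_quadratic, simp_all)
      finally show ?thesis
        using True by (simp add: ennreal_mult'[symmetric])
    qed simp
  qed
  \<comment> \<open>Translation v = K + u, applied to the right-hand integral; exp (- u) becomes exp
    K exp (- v), the source of the factor exp K.\<close>
  also have "\<dots> = (\<integral>\<^sup>+v. ennreal (exp (- (v - K)) * (pi / sqrt (p * v))) * indicator {K..} v \<partial>lborel)"
    by (subst (2) nn_integral_real_affine[where c = 1 and t = K]) (auto intro!: nn_integral_cong split: split_indicator)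
  also have "\<dots> = (\<integral>\<^sup>+v. ennreal (pi / sqrt p * exp K) * (ennreal (exp (- v) / sqrt v) * indicator {K..} v) \<partial>lborel)"
    using assms by (intro nn_integral_cong)
      (simp split: split_indicator add: ennreal_mult'[symmetric] exp_diff exp_minus real_sqrt_mult field_simps)
  also have "\<dots> = ennreal (pi / sqrt p * exp K) * ennreal (upper_incomplete_Gamma (1 / 2) K)"
    by (subst nn_integral_cmult) (simp_all only: ennreal_upper_incomplete_Gamma_half[OF assms(2)], simp_all)
  finally show ?thesis
    using assms by (simp add: ennreal_mult'[symmetric])
qed

text \<open>The sign facts here and below, with the measurability of \<open>Ei1\<close>, are the
  side conditions for returning to the Bochner integral. They hold for all real arguments, a
  non-integrable integrand giving 0.\<close>

lemma Ei1_nonneg: "0 \<le> Ei1 z"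
  unfolding Ei1_def set_lebesgue_integral_def
  by (intro integral_nonneg_AE AE_I2) (simp split: split_indicator)

lemma upper_incomplete_Gamma_nonneg: "0 \<le> upper_incomplete_Gamma \<mu> z"
  unfolding upper_incomplete_Gamma_def set_lebesgue_integral_def
  by (intro integral_nonneg_AE AE_I2) (simp split: split_indicator)

lemma Ei1_measurable [measurable]: "Ei1 \<in> borel_measurable borel"
  unfolding Ei1_def[abs_def] set_lebesgue_integral_def by measurable

theorem mainTheorem5:
  fixes a b c \<alpha> \<beta>\<^sub>1 \<beta>\<^sub>2 :: real
  assumes "a > 0" and "b > 0" and "c > 0" and "\<alpha> > 0"
    and "\<beta>\<^sub>1 = 2 * pi\<^sup>2 / (\<alpha> * c * (a + b))"
    and "\<beta>\<^sub>2 = (a + b)\<^sup>2 / (4 * pi\<^sup>2)"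
  shows "integrable lborel (C_approx_integrand a b c \<alpha>) \<and>
    C_approx a b c \<alpha> =
      pi / (ln 2 * sqrt \<beta>\<^sub>1) * exp (\<beta>\<^sub>1 * \<beta>\<^sub>2) * upper_incomplete_Gamma (1 / 2) (\<beta>\<^sub>1 * \<beta>\<^sub>2)"
proof -
  have pos: "0 < \<beta>\<^sub>1" "0 < \<beta>\<^sub>1 * \<beta>\<^sub>2"
    using assms by simp_all
  have arg: "1 / (2 * \<alpha> * sigma_hat_sq a b c f) = \<beta>\<^sub>1 * f\<^sup>2 + \<beta>\<^sub>1 * \<beta>\<^sub>2" for f
  proof -
    have "1 / (2 * \<alpha> * sigma_hat_sq a b c f) = ((a + b)\<^sup>2 + (2 * pi * f)\<^sup>2) / (2 * \<alpha> * c * (a + b))"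
      by (simp add: sigma_hat_sq_def)
    also have "\<dots> = \<beta>\<^sub>1 * f\<^sup>2 + \<beta>\<^sub>1 * \<beta>\<^sub>2"
    proof -
      \<comment> \<open>Here s stands for a + b, so that clearing denominators does not expand the
        sum. The constant term is s / (2 \<alpha> c), which is
        \<open>\<beta>\<^sub>1 * \<beta>\<^sub>2\<close>.\<close>
      have "(s\<^sup>2 + (2 * pi * f)\<^sup>2) / (2 * \<alpha> * c * s)
          = 2 * pi\<^sup>2 / (\<alpha> * c * s) * f\<^sup>2 + 2 * pi\<^sup>2 / (\<alpha> * c * s) * (s\<^sup>2 / (4 * pi\<^sup>2))" if "0 < s" for s
        using assms(3,4) that by (simp add: field_simps power2_eq_square)
      from this[of "a + b"] show ?thesis
        unfolding assms(5,6) using assms(1,2) by simp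
    qed
    finally show ?thesis .
  qed
  have integrand: "C_approx_integrand a b c \<alpha>
      = (\<lambda>f. exp (\<beta>\<^sub>1 * f\<^sup>2 + \<beta>\<^sub>1 * \<beta>\<^sub>2) * Ei1 (\<beta>\<^sub>1 * f\<^sup>2 + \<beta>\<^sub>1 * \<beta>\<^sub>2))"
    by (rule ext) (simp only: C_approx_integrand_def arg)
  \<comment> \<open>For a nonnegative measurable function, having a finite nonnegative integral of a
    given value is equivalent to being integrable with that value, so both conjuncts come at
    once.\<close>
  have "integrable lborel (C_approx_integrand a b c \<alpha>) \<and>
      (LINT f|lborel. C_approx_integrand a b c \<alpha> f)
        = pi / sqrt \<beta>\<^sub>1 * exp (\<beta>\<^sub>1 * \<beta>\<^sub>2) * upper_incomplete_Gamma (1 / 2) (\<beta>\<^sub>1 * \<beta>\<^sub>2)"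
    unfolding integrand
    using nn_integral_exp_mult_Ei1_quadratic[OF pos] pos
    by (subst nn_integral_eq_integrable[symmetric]) (simp_all add: Ei1_nonneg upper_incomplete_Gamma_nonneg)
  then show ?thesis
    by (simp add: C_approx_def)
qed

end
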